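(* Let $\mathbb{K}$ be an algebraically closed field, let $V$ be a vector space over $\mathbb{K}$ with finite positive dimension, and let $A,A^*$ be a tridiagonal pair on $V$. Then $A,A^*$ is sharp.
   Context: Let $\mathbb{K}$ be a field and $V$ a vector space over $\mathbb{K}$ with finite positive dimension. $\mathrm{End}(V)$ is the $\mathbb{K}$-algebra of all $\mathbb{K}$-linear maps $V\to V$. An eigenspace of $A\in\mathrm{End}(V)$ is a nonzero subspace of the form $\{v\in V\mid Av=\theta v\}$ with $\theta\in\mathbb{K}$; $A$ is diagonalizable if $V$ is spanned by the eigenspaces of $A$. A tridiagonal pair on $V$ is an ordered pair $A,A^*\in\mathrm{End}(V)$ (here $A^*$ is just a second linear map, not an adjoint) such that: (i) each of $A,A^*$ is diagonalizable; (ii) there is an ordering $\{V_i\}_{i=0}^d$ of the eigenspaces of $A$ with $A^*V_i\subseteq V_{i-1}+V_i+V_{i+1}$ for $0\le i\le d$, where $V_{-1}=0=V_{d+1}$; (iii) there is an ordering $\{V^*_i\}_{i=0}^\delta$ of the eigenspaces of $A^*$ with $AV^*_i\subseteq V^*_{i-1}+V^*_i+V^*_{i+1}$ for $0\le i\le\delta$, where $V^*_{-1}=0=V^*_{\delta+1}$; (iv) there is no subspace $W$ of $V$ with $AW\subseteq W$, $A^*W\subseteq W$, $W\ne0$, $W\ne V$. It is known that $d=\delta$ and that, for $0\le i\le d$, the spaces $V_i,V_{d-i},V^*_i,V^*_{d-i}$ have the same dimension, denoted $\rho_i$. The pair $A,A^*$ is called sharp if $\rho_0=1$. *)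

theory Defs
  imports "HOL-Computational_Algebra.Computational_Algebra"
begin

definition eigenspace ::
  "('k::field \<Rightarrow> 'v::ab_group_add \<Rightarrow> 'v) \<Rightarrow> ('v \<Rightarrow> 'v) \<Rightarrow> 'k \<Rightarrow> 'v set" where
  "eigenspace scale A \<theta> = {v. A v = scale \<theta> v}"

definition eigenspaces ::
  "('k::field \<Rightarrow> 'v::ab_group_add \<Rightarrow> 'v) \<Rightarrow> ('v \<Rightarrow> 'v) \<Rightarrow> 'v set set" where
  "eigenspaces scale A = {W. W \<noteq> {0} \<and> (\<exists>\<theta>. W = eigenspace scale A \<theta>)}"

definition diagonalizable ::
  "('k::field \<Rightarrow> 'v::ab_group_add \<Rightarrow> 'v) \<Rightarrow> ('v \<Rightarrow> 'v) \<Rightarrow> bool" where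
  "diagonalizable scale A \<longleftrightarrow> module.span scale (\<Union>(eigenspaces scale A)) = UNIV"

(* V_{i-1} + V_i + V_{i+1}, with the convention V_{-1} = 0 = V_{d+1}. *)
definition neighbour_sum :: "nat \<Rightarrow> (nat \<Rightarrow> 'v::ab_group_add set) \<Rightarrow> nat \<Rightarrow> 'v set" where
  "neighbour_sum d V i =
     {x + y + z | x y z.
        x \<in> (if i = 0 then {0} else V (i - 1)) \<and>
        y \<in> V i \<and>
        z \<in> (if i < d then V (i + 1) else {0})}"

(* V_0, ..., V_d lists each eigenspace of A exactly once, and B acts on the list
   in a block tridiagonal fashion. Values V i with i > d are irrelevant. *)
definition standard_ordering ::
  "('k::field \<Rightarrow> 'v::ab_group_add \<Rightarrow> 'v) \<Rightarrow> ('v \<Rightarrow> 'v) \<Rightarrow> ('v \<Rightarrow> 'v)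
     \<Rightarrow> nat \<Rightarrow> (nat \<Rightarrow> 'v set) \<Rightarrow> bool" where
  "standard_ordering scale A B d V \<longleftrightarrow>
     bij_betw V {0..d} (eigenspaces scale A) \<and>
     (\<forall>i\<le>d. B ` V i \<subseteq> neighbour_sum d V i)"

definition tridiagonal_pair ::
  "('k::field \<Rightarrow> 'v::ab_group_add \<Rightarrow> 'v) \<Rightarrow> ('v \<Rightarrow> 'v) \<Rightarrow> ('v \<Rightarrow> 'v) \<Rightarrow> bool" where
  "tridiagonal_pair scale A As \<longleftrightarrow>
     Vector_Spaces.linear scale scale A \<and> Vector_Spaces.linear scale scale As \<and>
     diagonalizable scale A \<and> diagonalizable scale As \<and>
     (\<exists>d V. standard_ordering scale A As d V) \<and>
     (\<exists>\<delta> Vs. standard_ordering scale As A \<delta> Vs) \<and>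
     \<not> (\<exists>W. module.subspace scale W \<and> A ` W \<subseteq> W \<and> As ` W \<subseteq> W \<and> W \<noteq> {0} \<and> W \<noteq> UNIV)"

(* For a tridiagonal pair it is known that d = \<delta> and that V_i, V_{d-i}, Vs_i, Vs_{d-i}
   have a common dimension rho_i, independent of the chosen orderings. Since this is a
   theorem and not part of the definition, rho_i = r is expressed as a relation that
   asks for all four dimensions, for every choice of the orderings. It is meant for i \<le> d. *)
definition has_rho ::
  "('k::field \<Rightarrow> 'v::ab_group_add \<Rightarrow> 'v) \<Rightarrow> ('v \<Rightarrow> 'v) \<Rightarrow> ('v \<Rightarrow> 'v)
     \<Rightarrow> nat \<Rightarrow> nat \<Rightarrow> bool" where
  "has_rho scale A As i r \<longleftrightarrow>
     (\<forall>d V \<delta> Vs. standard_ordering scale A As d V \<longrightarrow> standard_ordering scale As A \<delta> Vs \<longrightarrow>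
        vector_space.dim scale (V i) = r \<and> vector_space.dim scale (V (d - i)) = r \<and>
        vector_space.dim scale (Vs i) = r \<and> vector_space.dim scale (Vs (\<delta> - i)) = r)"

definition sharp ::
  "('k::field \<Rightarrow> 'v::ab_group_add \<Rightarrow> 'v) \<Rightarrow> ('v \<Rightarrow> 'v) \<Rightarrow> ('v \<Rightarrow> 'v) \<Rightarrow> bool" where
  "sharp scale A As \<longleftrightarrow> tridiagonal_pair scale A As \<and> has_rho scale A As 0 1"

end

theory Submission
  imports Defs
begin

text \<open>
  Let \<open>E\<^sub>0\<^sup>*\<close> be the projection onto the first eigenspace of \<open>A\<^sup>*\<close>, and let \<open>T\<close> be the algebra
  generated by \<open>A\<close> and \<open>A\<^sup>*\<close>. The tridiagonal conditions alone imply that the elements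
  \<open>E\<^sub>0\<^sup>* X E\<^sub>0\<^sup>*\<close>, with \<open>X\<close> a polynomial in \<open>A\<close>, commute and generate \<open>E\<^sub>0\<^sup>* T E\<^sub>0\<^sup>*\<close>. Over an
  algebraically closed field they have a common eigenvector \<open>v\<close> in \<open>E\<^sub>0\<^sup>* V\<close>. Irreducibility gives
  \<open>T v = V\<close>, hence \<open>E\<^sub>0\<^sup>* V = E\<^sub>0\<^sup>* T v\<close> is the line spanned by \<open>v\<close>.

  Both facts rest on one observation. If \<open>q\<close> is a polynomial of degree at most \<open>b\<close>, the blocks
  \<open>E\<^sub>i q(A\<^sup>*) E\<^sub>j\<close> vanish for \<open>\<bar>i - j\<bar> > b\<close>, so a relation between products
  \<open>X q(A\<^sup>*) Y\<close>, with \<open>X\<close> and \<open>Y\<close> polynomials in \<open>A\<close>, amounts to an identity between functions on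
  the band \<open>\<bar>i - j\<bar> \<le> b\<close> of the grid of pairs of eigenvalues of \<open>A\<close>.
\<close>

section \<open>Interpolation and functions on a band of the grid\<close>

lemma poly_interpolation:
  fixes x g :: "'a \<Rightarrow> 'k::field"
  assumes "finite S" "inj_on x S" "card S \<le> Suc n"
  shows "\<exists>p. degree p \<le> n \<and> (\<forall>s\<in>S. poly p (x s) = g s)"
  using assms
proof (induction S arbitrary: n rule: finite_induct)
  case empty
  show ?case by (intro exI[of _ 0]) auto
next
  case (insert a S)
  show ?case
  proof (cases "S = {}")
    case True
    then show ?thesis by (intro exI[of _ "[:g a:]"]) auto
  next
    case False
    then have "card S > 0" using insert by (simp add: card_gt_0_iff)
    then obtain m where n: "n = Suc m" using insert by (cases n) auto
    obtain p where p: "degree p \<le> m" "\<forall>s\<in>S. poly p (x s) = g s"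
      using insert.IH[of m] insert.prems insert.hyps n by auto
    define w where "w = (\<Prod>s\<in>S. [:- x s, 1:])"
    have degw: "degree w \<le> n"
      unfolding w_def using insert.prems insert.hyps by (intro order.trans[OF degree_prod_sum_le]) auto
    have wS: "poly w (x s) = 0" if "s \<in> S" for s
      using that insert.hyps by (auto simp: w_def poly_prod)
    have wa: "poly w (x a) \<noteq> 0"
      using insert by (auto simp: w_def poly_prod)
    \<comment> \<open>Newton's step: \<open>w\<close> vanishes at the earlier nodes but not at
      \<open>x a\<close>, so a multiple of it corrects the new value alone.\<close>
    define q where "q = p + smult ((g a - poly p (x a)) / poly w (x a)) w"
    have "degree q \<le> n"
      unfolding q_def using p n degw
      by (intro degree_add_le order.trans[OF degree_smult_le]) auto
    then show ?thesis
      using p wS wa by (intro exI[of _ q]) (auto simp: q_def)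
  qed
qed

text \<open>
  Proved by adding one row and one column of the band at a time, from the last index downwards.
  The new row (off the diagonal) has \<open>b\<close> entries and the new column \<open>b + 1\<close>, as many as the free
  coefficients.
\<close>

lemma band_decomposition:
  fixes x :: "nat \<Rightarrow> 'k::field" and f :: "nat \<Rightarrow> nat \<Rightarrow> 'k"
  assumes inj: "inj_on x {..d}" and b: "b > 0"
  shows "\<exists>P R. (\<forall>i. degree (P i) \<le> b \<and> degree (R i) \<le> b - 1) \<and>
    (\<forall>i\<le>d. \<forall>j\<le>d. i \<le> j + b \<longrightarrow> j \<le> i + b \<longrightarrow> f i j = poly (P j) (x i) + poly (R i) (x j))"
proof -
  have "\<exists>P R. (\<forall>i. degree (P i) \<le> b \<and> degree (R i) \<le> b - 1) \<and>
    (\<forall>i\<in>{k..d}. \<forall>j\<in>{k..d}. i \<le> j + b \<longrightarrow> j \<le> i + b \<longrightarrow>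
       f i j = poly (P j) (x i) + poly (R i) (x j))" if "k \<le> Suc d" for k
    using that
  proof (induction k rule: inc_induct)
    case base
    show ?case by (intro exI[of _ "\<lambda>_. 0"]) auto
  next
    case (step k)
    then obtain P R where deg: "\<And>i. degree (P i) \<le> b" "\<And>i. degree (R i) \<le> b - 1"
      and PR: "\<And>i j. i \<in> {Suc k..d} \<Longrightarrow> j \<in> {Suc k..d} \<Longrightarrow> i \<le> j + b \<Longrightarrow> j \<le> i + b \<Longrightarrow>
        f i j = poly (P j) (x i) + poly (R i) (x j)" by metis
    have "\<exists>r. degree r \<le> b - 1 \<and>
        (\<forall>j\<in>{Suc k..min d (k + b)}. poly r (x j) = f k j - poly (P j) (x k))"
      using inj b by (intro poly_interpolation) (auto intro: inj_on_subset)
    then obtain r where r: "degree r \<le> b - 1"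
      "\<And>j. j \<in> {Suc k..min d (k + b)} \<Longrightarrow> poly r (x j) = f k j - poly (P j) (x k)" by metis
    \<comment> \<open>The row is fitted first, without the diagonal. The column then includes the
      entry \<open>(k, k)\<close>, so it must be fitted against the updated
      \<open>R(k := r)\<close>.\<close>
    have "\<exists>p. degree p \<le> b \<and>
        (\<forall>i\<in>{k..min d (k + b)}. poly p (x i) = f i k - poly ((R(k := r)) i) (x k))"
      using inj by (intro poly_interpolation) (auto intro: inj_on_subset)
    then obtain p where p: "degree p \<le> b"
      "\<And>i. i \<in> {k..min d (k + b)} \<Longrightarrow> poly p (x i) = f i k - poly ((R(k := r)) i) (x k)" by metis
    show ?case
    proof (rule exI[of _ "P(k := p)"], rule exI[of _ "R(k := r)"], intro conjI allI ballI impI)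
      fix i j assume ij: "i \<in> {k..d}" "j \<in> {k..d}" "i \<le> j + b" "j \<le> i + b"
      consider "j = k" | "i = k" "j \<noteq> k" | "i \<noteq> k" "j \<noteq> k" by blast
      then show "f i j = poly ((P(k := p)) j) (x i) + poly ((R(k := r)) i) (x j)"
      proof cases
        case 1
        then show ?thesis using ij p(2)[of i] by simp
      next
        case 2
        then show ?thesis using ij r(2)[of j] by simp
      next
        case 3
        then show ?thesis using ij PR[of i j] by simp
      qed
    qed (use deg p(1) r(1) in auto)
  qed
  from this[of 0] show ?thesis by (simp add: atLeast0AtMost Ball_def)
qed

text \<open>The same recursion as before. By antisymmetry the conditions for the new row repeat
  those for the new column, and the diagonal holds automatically, so a single polynomial with
  \<open>b\<close> coefficients serves for both.\<close>

lemma antisymmetric_band_decomposition: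
  fixes x :: "nat \<Rightarrow> 'k::field" and f :: "nat \<Rightarrow> nat \<Rightarrow> 'k"
  assumes inj: "inj_on x {..d}" and b: "b > 0"
    and anti: "\<And>i j. f i j = - f j i" and diag: "\<And>i. f i i = 0"
  shows "\<exists>Z. (\<forall>i. degree (Z i) \<le> b - 1) \<and>
    (\<forall>i\<le>d. \<forall>j\<le>d. i \<le> j + b \<longrightarrow> j \<le> i + b \<longrightarrow> f i j = poly (Z j) (x i) - poly (Z i) (x j))"
proof -
  have "\<exists>Z. (\<forall>i. degree (Z i) \<le> b - 1) \<and>
    (\<forall>i\<in>{k..d}. \<forall>j\<in>{k..d}. i \<le> j + b \<longrightarrow> j \<le> i + b \<longrightarrow>
       f i j = poly (Z j) (x i) - poly (Z i) (x j))" if "k \<le> Suc d" for k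
    using that
  proof (induction k rule: inc_induct)
    case base
    show ?case by (intro exI[of _ "\<lambda>_. 0"]) auto
  next
    case (step k)
    then obtain Z where deg: "\<And>i. degree (Z i) \<le> b - 1"
      and Z: "\<And>i j. i \<in> {Suc k..d} \<Longrightarrow> j \<in> {Suc k..d} \<Longrightarrow> i \<le> j + b \<Longrightarrow> j \<le> i + b \<Longrightarrow>
        f i j = poly (Z j) (x i) - poly (Z i) (x j)" by metis
    have "\<exists>z. degree z \<le> b - 1 \<and>
        (\<forall>i\<in>{Suc k..min d (k + b)}. poly z (x i) = f i k + poly (Z i) (x k))"
      using inj b by (intro poly_interpolation) (auto intro: inj_on_subset)
    then obtain z where z: "degree z \<le> b - 1"
      "\<And>i. i \<in> {Suc k..min d (k + b)} \<Longrightarrow> poly z (x i) = f i k + poly (Z i) (x k)" by metis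
    show ?case
    proof (rule exI[of _ "Z(k := z)"], intro conjI allI ballI impI)
      fix i j assume ij: "i \<in> {k..d}" "j \<in> {k..d}" "i \<le> j + b" "j \<le> i + b"
      consider "i = k" "j = k" | "i \<noteq> k" "j = k" | "i = k" "j \<noteq> k" | "i \<noteq> k" "j \<noteq> k" by blast
      then show "f i j = poly ((Z(k := z)) j) (x i) - poly ((Z(k := z)) i) (x j)"
      proof cases
        case 1
        then show ?thesis using diag by simp
      next
        case 2
        then show ?thesis using ij z(2)[of i] by simp
      next
        case 3
        then show ?thesis using ij z(2)[of j] anti[of k j] by simp
      next
        case 4
        then show ?thesis using ij Z[of i j] by simp
      qed
    qed (use deg z(1) in auto)
  qed
  from this[of 0] show ?thesis by auto
qed

section \<open>Polynomials in a linear operator\<close>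

locale operator_polynomials = vector_space scale
  for scale :: "'k::field \<Rightarrow> 'v::ab_group_add \<Rightarrow> 'v"
begin

sublocale endo: vector_space_pair scale scale ..

definition peval :: "('v \<Rightarrow> 'v) \<Rightarrow> 'k poly \<Rightarrow> 'v \<Rightarrow> 'v" where
  "peval T p v = (\<Sum>i\<le>degree p. scale (coeff p i) ((T ^^ i) v))"

lemma peval_0 [simp]: "peval T 0 v = 0"
  by (simp add: peval_def)

lemma linear_funpow:
  assumes "Vector_Spaces.linear scale scale T"
  shows "Vector_Spaces.linear scale scale (T ^^ n)"
proof (induction n)
  case 0
  show ?case unfolding funpow.simps by (rule linear_id)
next
  case (Suc n)
  then show ?case
    unfolding funpow.simps by (rule Vector_Spaces.linear_compose[OF _ assms])
qed

lemma linear_peval: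
  assumes "Vector_Spaces.linear scale scale T"
  shows "Vector_Spaces.linear scale scale (peval T p)"
  unfolding peval_def
  by (intro endo.linear_compose_sum ballI endo.linear_compose_scale_right linear_funpow[OF assms])

lemma peval_pCons:
  assumes "Vector_Spaces.linear scale scale T"
  shows "peval T (pCons a p) v = scale a v + T (peval T p v)"
proof (cases "p = 0")
  case True
  then show ?thesis by (simp add: peval_def endo.linear_0[OF assms])
next
  case False
  then show ?thesis
    by (simp add: peval_def endo.linear_sum[OF assms] endo.linear_scale[OF assms]
        sum.atMost_Suc_shift del: sum.atMost_Suc)
qed

lemma peval_const:
  assumes "Vector_Spaces.linear scale scale T"
  shows "peval T [:a:] v = scale a v"
  by (simp add: peval_pCons[OF assms] endo.linear_0[OF assms])

lemma peval_add:
  assumes "Vector_Spaces.linear scale scale T"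
  shows "peval T (p + q) v = peval T p v + peval T q v"
  by (induction p q rule: poly_induct2)
    (simp_all add: peval_pCons[OF assms] endo.linear_add[OF assms] algebra_simps)

lemma peval_smult:
  assumes "Vector_Spaces.linear scale scale T"
  shows "peval T (smult a p) v = scale a (peval T p v)"
  by (induction p)
    (simp_all add: peval_pCons[OF assms] endo.linear_scale[OF assms] algebra_simps)

lemma peval_mult:
  assumes "Vector_Spaces.linear scale scale T"
  shows "peval T (p * q) v = peval T p (peval T q v)"
  by (induction p)
    (simp_all add: peval_pCons[OF assms] peval_add[OF assms] peval_smult[OF assms] algebra_simps)

lemma peval_eigenvector:
  assumes "Vector_Spaces.linear scale scale T" and "T v = scale a v"
  shows "peval T p v = scale (poly p a) v"
  by (induction p)
    (simp_all add: peval_pCons[OF assms(1)] endo.linear_scale[OF assms(1)] assms(2) algebra_simps)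

lemma peval_monom:
  assumes "Vector_Spaces.linear scale scale T"
  shows "peval T (monom 1 n) u = (T ^^ n) u"
proof (induction n)
  case 0
  show ?case using peval_const[OF assms, of 1 u] by (simp add: one_pCons)
next
  case (Suc n)
  then show ?case by (simp add: monom_Suc peval_pCons[OF assms])
qed

text \<open>In finite dimension the vectors \<open>(T ^^ i) u\<close> cannot stay independent. The
  first dependence writes some \<open>(T ^^ n) u\<close> as a polynomial of lower degree in
  \<open>T\<close> applied to \<open>u\<close>.\<close>

lemma annihilating_polynomial:
  assumes fin: "finite_dimensional_vector_space scale Basis"
    and T: "Vector_Spaces.linear scale scale T"
  shows "\<exists>p. p \<noteq> 0 \<and> peval T p u = 0"
proof -
  interpret fin: finite_dimensional_vector_space scale Basis by fact
  let ?S = "\<lambda>n. (\<lambda>i. (T ^^ i) u) ` {..<n}"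
  have "\<exists>n. (T ^^ n) u \<in> span (?S n)"
  proof (rule ccontr)
    assume none: "\<nexists>n. (T ^^ n) u \<in> span (?S n)"
    then have notin: "(T ^^ n) u \<notin> span (?S n)" for n by simp
    have "independent (?S n) \<and> card (?S n) = n" for n
    proof (induction n)
      case 0
      show ?case by (simp add: independent_empty)
    next
      case (Suc n)
      have "(T ^^ n) u \<notin> ?S n" using notin[of n] span_base[of "(T ^^ n) u" "?S n"] by argo
      then show ?case
        using Suc notin[of n] by (simp add: lessThan_Suc independent_insertI)
    qed
    then have "Suc (fin.dimension) \<le> fin.dimension"
      using fin.independent_card_le_dim[OF subset_UNIV, of "?S (Suc fin.dimension)"]
      by (metis fin.dim_UNIV fin.dimension_def)
    then show False by simp
  qed
  then obtain n where n: "(T ^^ n) u \<in> span (?S n)" by blast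
  \<comment> \<open>The alternative \<open>q = 0\<close> keeps the set nonempty when
    \<open>n = 0\<close>.\<close>
  let ?P = "{peval T q u | q. degree q < n \<or> q = 0}"
  have "subspace ?P"
  proof (rule subspaceI)
    show "0 \<in> ?P" by (auto intro!: exI[of _ 0])
  next
    fix x y assume "x \<in> ?P" "y \<in> ?P"
    then obtain p q where "x = peval T p u" "y = peval T q u"
      "degree p < n \<or> p = 0" "degree q < n \<or> q = 0" by auto
    then show "x + y \<in> ?P"
      by (auto simp: peval_add[OF T, symmetric] intro!: exI[of _ "p + q"] degree_add_less)
  next
    fix c x assume "x \<in> ?P"
    then obtain p where "x = peval T p u" "degree p < n \<or> p = 0" by auto
    then show "scale c x \<in> ?P"
      by (auto simp: peval_smult[OF T, symmetric] intro!: exI[of _ "smult c p"])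
  qed
  moreover have "?S n \<subseteq> ?P"
  proof
    fix x assume "x \<in> ?S n"
    then obtain i where "i < n" "x = peval T (monom 1 i) u" by (auto simp: peval_monom[OF T])
    then show "x \<in> ?P" by (auto simp: degree_monom_eq intro!: exI[of _ "monom 1 i"])
  qed
  ultimately have "(T ^^ n) u \<in> ?P" using n span_minimal by blast
  then obtain q where q: "(T ^^ n) u = peval T q u" "degree q < n \<or> q = 0" by auto
  have "coeff (monom 1 n + smult (- 1) q) n = 1" using q(2) by (auto simp: coeff_eq_0)
  then have "monom 1 n + smult (- 1) q \<noteq> 0" by (metis coeff_0 zero_neq_one)
  moreover have "peval T (monom 1 n + smult (- 1) q) u = 0"
    by (simp only: peval_add[OF T] peval_smult[OF T] peval_monom[OF T] q(1)) simp
  ultimately show ?thesis by blast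
qed

end

subsection \<open>Relations in a tridiagonal system\<close>

text \<open>The index \<open>c\<close> tells the two operators of the pair apart: \<open>A c\<close> and \<open>A (\<not> c)\<close> play the
  roles of \<open>A\<close> and \<open>A\<^sup>*\<close>, in either order.\<close>

locale tridiagonal_system = operator_polynomials scale
  for scale :: "'k::field \<Rightarrow> 'v::ab_group_add \<Rightarrow> 'v" +
  fixes A :: "bool \<Rightarrow> 'v \<Rightarrow> 'v" and d :: "bool \<Rightarrow> nat"
    and \<theta> :: "bool \<Rightarrow> nat \<Rightarrow> 'k" and E :: "bool \<Rightarrow> nat \<Rightarrow> 'v \<Rightarrow> 'v"
  assumes linear_A: "Vector_Spaces.linear scale scale (A c)"
    and linear_E: "Vector_Spaces.linear scale scale (E c i)"
    and sum_E: "(\<Sum>i\<le>d c. E c i v) = v"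
    and E_E: "i \<le> d c \<Longrightarrow> j \<le> d c \<Longrightarrow> E c i (E c j v) = (if i = j then E c i v else 0)"
    and A_E: "i \<le> d c \<Longrightarrow> A c (E c i v) = scale (\<theta> c i) (E c i v)"
    and inj_\<theta>: "inj_on (\<theta> c) {..d c}"
    and tridiagonal: "i \<le> d c \<Longrightarrow> j \<le> d c \<Longrightarrow> i + 1 < j \<or> j + 1 < i \<Longrightarrow>
      E c i (A (\<not> c) (E c j v)) = 0"
begin

lemmas linear_op = linear_peval[OF linear_A]

lemma peval_eq_sum: "peval (A c) p v = (\<Sum>i\<le>d c. scale (poly p (\<theta> c i)) (E c i v))"
proof -
  have "peval (A c) p v = (\<Sum>i\<le>d c. peval (A c) p (E c i v))"
    using sum_E[of c v] endo.linear_sum[OF linear_op, of c p "\<lambda>i. E c i v" "{..d c}"] by simp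
  also have "\<dots> = (\<Sum>i\<le>d c. scale (poly p (\<theta> c i)) (E c i v))"
    by (intro sum.cong refl peval_eigenvector linear_A A_E) simp
  finally show ?thesis .
qed

lemma E_peval:
  assumes "i \<le> d c"
  shows "E c i (peval (A c) p v) = scale (poly p (\<theta> c i)) (E c i v)"
proof -
  have "E c i (peval (A c) p v) = (\<Sum>j\<le>d c. if j = i then scale (poly p (\<theta> c i)) (E c i v) else 0)"
    unfolding peval_eq_sum endo.linear_sum[OF linear_E] endo.linear_scale[OF linear_E]
    using assms by (intro sum.cong) (auto simp: E_E)
  then show ?thesis using assms by simp
qed

lemma peval_E:
  assumes "i \<le> d c"
  shows "peval (A c) p (E c i v) = scale (poly p (\<theta> c i)) (E c i v)"
  by (intro peval_eigenvector linear_A A_E assms)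

text \<open>Lagrange polynomials at the eigenvalues. They let a projection stand wherever a
  polynomial factor is expected.\<close>

lemma E_eq_peval:
  assumes "j \<le> d c"
  shows "\<exists>p. (\<forall>i\<le>d c. poly p (\<theta> c i) = (if i = j then 1 else 0)) \<and>
    (\<forall>v. peval (A c) p v = E c j v)"
proof -
  obtain p where p: "\<And>i. i \<le> d c \<Longrightarrow> poly p (\<theta> c i) = (if i = j then 1 else 0)"
    using poly_interpolation[OF _ inj_\<theta>, of c "d c" "\<lambda>i. if i = j then 1 else 0"] by auto
  have "peval (A c) p v = (\<Sum>i\<le>d c. if i = j then E c j v else 0)" for v
    unfolding peval_eq_sum using p by (intro sum.cong) auto
  then show ?thesis using assms p by (intro exI[of _ p]) simp
qed

text \<open>Each application of \<open>A (\<not> c)\<close> shifts the block index by at most one,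
  so a polynomial in it shifts the index by at most its degree.\<close>

lemma banded:
  assumes "i \<le> d c" "j \<le> d c" "i + degree q < j \<or> j + degree q < i"
  shows "E c i (peval (A (\<not> c)) q (E c j v)) = 0"
  using assms
proof (induction q arbitrary: i)
  case 0
  then show ?case by (simp add: endo.linear_0[OF linear_E])
next
  case (pCons a q)
  let ?w = "peval (A (\<not> c)) q (E c j v)"
  \<comment> \<open>The identity is inserted as the sum of the \<open>E c k\<close>. Indices
    \<open>k\<close> far from \<open>i\<close> vanish by \<open>tridiagonal\<close>; those near
    \<open>i\<close> are still too far from \<open>j\<close> for \<open>q\<close>.\<close>
  have "E c i (A (\<not> c) (E c k ?w)) = 0" if "k \<le> d c" for k
  proof (cases "i + 1 < k \<or> k + 1 < i")
    case True
    then show ?thesis using that pCons.prems tridiagonal by blast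
  next
    case False
    then have "E c k ?w = 0"
    \<comment> \<open>For \<open>q = 0\<close> the degree does not drop from
      \<open>pCons a q\<close> to \<open>q\<close>, so the induction hypothesis gives
      nothing.\<close>
    proof (cases "q = 0")
      case True
      then show ?thesis by (simp add: endo.linear_0[OF linear_E])
    next
      case q: False
      then show ?thesis using False pCons.prems that by (intro pCons.IH) auto
    qed
    then show ?thesis by (simp add: endo.linear_0[OF linear_E] endo.linear_0[OF linear_A])
  qed
  then have "(\<Sum>k\<le>d c. E c i (A (\<not> c) (E c k ?w))) = 0" by simp
  then have "E c i (A (\<not> c) ?w) = 0"
    unfolding endo.linear_sum[OF linear_E, symmetric] endo.linear_sum[OF linear_A, symmetric] sum_E .
  moreover have "E c i (E c j v) = 0" using pCons.prems by (auto simp: E_E)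
  ultimately show ?case
    by (simp add: peval_pCons[OF linear_A] endo.linear_add[OF linear_E] endo.linear_scale[OF linear_E])
qed

lemma peval_peval_peval:
  "peval (A c) p (peval (A (\<not> c)) q (peval (A c) r v)) =
     (\<Sum>i\<le>d c. \<Sum>j\<le>d c. scale (poly p (\<theta> c i) * poly r (\<theta> c j))
        (E c i (peval (A (\<not> c)) q (E c j v))))"
  unfolding peval_eq_sum[of c]
  by (simp add: endo.linear_sum[OF linear_op] endo.linear_sum[OF linear_E] scale_sum_right
      endo.linear_scale[OF linear_op] endo.linear_scale[OF linear_E])

text \<open>By \<open>banded\<close> the blocks off the band vanish, so coefficients matter only on
  the band.\<close>

lemma band_sum_cong:
  assumes "\<And>i j. i \<le> d c \<Longrightarrow> j \<le> d c \<Longrightarrow> i \<le> j + degree q \<Longrightarrow> j \<le> i + degree q \<Longrightarrow> f i j = g i j"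
  shows "(\<Sum>i\<le>d c. \<Sum>j\<le>d c. scale (f i j) (E c i (peval (A (\<not> c)) q (E c j v)))) =
     (\<Sum>i\<le>d c. \<Sum>j\<le>d c. scale (g i j) (E c i (peval (A (\<not> c)) q (E c j v))))"
proof (intro sum.cong refl)
  fix i j assume ij: "i \<in> {..d c}" "j \<in> {..d c}"
  show "scale (f i j) (E c i (peval (A (\<not> c)) q (E c j v))) =
    scale (g i j) (E c i (peval (A (\<not> c)) q (E c j v)))"
  proof (cases "i \<le> j + degree q \<and> j \<le> i + degree q")
    case True
    then show ?thesis using assms ij by simp
  next
    case False
    then show ?thesis using ij banded[of i c j q v] by auto
  qed
qed

text \<open>The operator form of the coefficients \<open>poly (P j) (\<theta> c i)\<close>: the
  polynomial stands on the left, its index is carried by the projection on the right.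
  \<open>sum_E_peval\<close> is the mirror image.\<close>

lemma sum_peval_E:
  "(\<Sum>j\<le>d c. peval (A c) (P j) (peval (A (\<not> c)) q (E c j v))) =
    (\<Sum>i\<le>d c. \<Sum>j\<le>d c. scale (poly (P j) (\<theta> c i)) (E c i (peval (A (\<not> c)) q (E c j v))))"
  unfolding peval_eq_sum[of c "P _"] by (rule sum.swap)

lemma sum_E_peval:
  "(\<Sum>i\<le>d c. E c i (peval (A (\<not> c)) q (peval (A c) (R i) v))) =
    (\<Sum>i\<le>d c. \<Sum>j\<le>d c. scale (poly (R i) (\<theta> c j)) (E c i (peval (A (\<not> c)) q (E c j v))))"
  unfolding peval_eq_sum[of c "R _"]
  by (simp add: endo.linear_sum[OF linear_op] endo.linear_sum[OF linear_E]
      endo.linear_scale[OF linear_op] endo.linear_scale[OF linear_E])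

text \<open>\<open>band_decomposition\<close> for the product of the two outer polynomials.
  Arbitrary outer factors are traded for a projection on one side and a factor of bounded degree on
  the other.\<close>

lemma exchange:
  assumes "degree q \<le> b" "b > 0"
  shows "\<exists>P R. (\<forall>i. degree (P i) \<le> b \<and> degree (R i) \<le> b - 1) \<and>
    (\<forall>v. peval (A c) p (peval (A (\<not> c)) q (peval (A c) r v)) =
      (\<Sum>j\<le>d c. peval (A c) (P j) (peval (A (\<not> c)) q (E c j v))) +
      (\<Sum>i\<le>d c. E c i (peval (A (\<not> c)) q (peval (A c) (R i) v))))"
proof -
  obtain P R where PR: "(\<forall>i. degree (P i) \<le> b \<and> degree (R i) \<le> b - 1) \<and>
    (\<forall>i\<le>d c. \<forall>j\<le>d c. i \<le> j + b \<longrightarrow> j \<le> i + b \<longrightarrow>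
      poly p (\<theta> c i) * poly r (\<theta> c j) = poly (P j) (\<theta> c i) + poly (R i) (\<theta> c j))"
    using band_decomposition[OF inj_\<theta> assms(2), of c "\<lambda>i j. poly p (\<theta> c i) * poly r (\<theta> c j)"]
    by blast
  have "peval (A c) p (peval (A (\<not> c)) q (peval (A c) r v)) =
      (\<Sum>j\<le>d c. peval (A c) (P j) (peval (A (\<not> c)) q (E c j v))) +
      (\<Sum>i\<le>d c. E c i (peval (A (\<not> c)) q (peval (A c) (R i) v)))" for v
    unfolding peval_peval_peval sum_peval_E sum_E_peval sum.distrib[symmetric] scale_left_distrib[symmetric]
    using assms(1) PR by (intro band_sum_cong) auto
  with PR show ?thesis by blast
qed

text \<open>Swapping the outer factors gives an antisymmetric coefficient function that is zero on
  the diagonal, so both kinds of terms share the same \<open>Z\<close>.\<close>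

lemma antisymmetric_exchange:
  assumes "degree q \<le> b" "b > 0"
  shows "\<exists>Z. (\<forall>i. degree (Z i) \<le> b - 1) \<and>
    (\<forall>v. peval (A c) p (peval (A (\<not> c)) q (peval (A c) r v)) -
         peval (A c) r (peval (A (\<not> c)) q (peval (A c) p v)) =
      (\<Sum>j\<le>d c. peval (A c) (Z j) (peval (A (\<not> c)) q (E c j v))) -
      (\<Sum>i\<le>d c. E c i (peval (A (\<not> c)) q (peval (A c) (Z i) v))))"
proof -
  let ?f = "\<lambda>i j. poly p (\<theta> c i) * poly r (\<theta> c j) - poly r (\<theta> c i) * poly p (\<theta> c j)"
  have "?f i j = - ?f j i" "?f i i = 0" for i j
    by (simp_all add: mult.commute)
  then obtain Z where Z: "(\<forall>i. degree (Z i) \<le> b - 1) \<and>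
    (\<forall>i\<le>d c. \<forall>j\<le>d c. i \<le> j + b \<longrightarrow> j \<le> i + b \<longrightarrow>
      ?f i j = poly (Z j) (\<theta> c i) - poly (Z i) (\<theta> c j))"
    using antisymmetric_band_decomposition[OF inj_\<theta> assms(2), of ?f c] by blast
  have "peval (A c) p (peval (A (\<not> c)) q (peval (A c) r v)) -
         peval (A c) r (peval (A (\<not> c)) q (peval (A c) p v)) =
      (\<Sum>j\<le>d c. peval (A c) (Z j) (peval (A (\<not> c)) q (E c j v))) -
      (\<Sum>i\<le>d c. E c i (peval (A (\<not> c)) q (peval (A c) (Z i) v)))" for v
    unfolding peval_peval_peval sum_peval_E sum_E_peval sum_subtractf[symmetric] scale_left_diff_distrib[symmetric]
    using assms(1) Z by (intro band_sum_cong) auto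
  with Z show ?thesis by blast
qed

text \<open>From block \<open>l\<close> a polynomial of degree at most \<open>m\<close> reaches
  block 0 only if \<open>l \<le> m\<close>, so the other eigenvalues are invisible.\<close>

lemma truncate_left:
  assumes "degree p \<le> m" and "\<And>l. l \<le> m \<Longrightarrow> l \<le> d c \<Longrightarrow> poly q (\<theta> c l) = poly q' (\<theta> c l)"
  shows "E c 0 (peval (A (\<not> c)) p (peval (A c) q v)) = E c 0 (peval (A (\<not> c)) p (peval (A c) q' v))"
proof -
  have "scale (poly q (\<theta> c l)) (E c 0 (peval (A (\<not> c)) p (E c l v))) =
      scale (poly q' (\<theta> c l)) (E c 0 (peval (A (\<not> c)) p (E c l v)))" if "l \<le> d c" for l
    using that assms banded[of 0 c l p v] by (cases "l \<le> m") auto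
  then show ?thesis
    by (auto simp: peval_eq_sum[of c] endo.linear_sum[OF linear_op] endo.linear_sum[OF linear_E]
      endo.linear_scale[OF linear_op] endo.linear_scale[OF linear_E] simp del: scale_cancel_right
      intro!: sum.cong)
qed

lemma truncate_right:
  assumes "degree p \<le> m" and "\<And>l. l \<le> m \<Longrightarrow> l \<le> d c \<Longrightarrow> poly q (\<theta> c l) = poly q' (\<theta> c l)"
  shows "peval (A c) q (peval (A (\<not> c)) p (E c 0 v)) = peval (A c) q' (peval (A (\<not> c)) p (E c 0 v))"
proof -
  have "scale (poly q (\<theta> c l)) (E c l (peval (A (\<not> c)) p (E c 0 v))) =
      scale (poly q' (\<theta> c l)) (E c l (peval (A (\<not> c)) p (E c 0 v)))" if "l \<le> d c" for l
    using that assms banded[of l c 0 p v] by (cases "l \<le> m") auto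
  then show ?thesis by (auto simp: peval_eq_sum[of c] simp del: scale_cancel_right intro!: sum.cong)
qed

text \<open>
  By the antisymmetric exchange the defect is a sum of similar defects in which one outer factor
  has degree less than that of \<open>q\<close>. Next to \<open>E c 0\<close> such a factor sees only the first \<open>degree q\<close>
  eigenvalues, so \<open>q\<close> may be replaced by an interpolating polynomial of smaller degree.
\<close>

lemma corner_symmetric:
  "E c 0 (peval (A (\<not> c)) p (peval (A c) q (peval (A (\<not> c)) r (E c 0 v)))) =
   E c 0 (peval (A (\<not> c)) r (peval (A c) q (peval (A (\<not> c)) p (E c 0 v))))"
proof (induction "degree q" arbitrary: q p r rule: less_induct)
  case less
  show ?case
  proof (cases "degree q = 0")
    case True
    \<comment> \<open>For constant \<open>q\<close> the factors \<open>p\<close> and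
      \<open>r\<close> are polynomials in the same operator and commute.\<close>
    then obtain a where "q = [:a:]" by (metis degree_eq_zeroE)
    then show ?thesis
      by (simp add: peval_const[OF linear_A] endo.linear_scale[OF linear_op]
          peval_mult[OF linear_A, symmetric] mult.commute)
  next
    case False
    let ?c = "\<not> c" and ?v = "E c 0 v"
    obtain Z where Z: "\<And>i. degree (Z i) \<le> degree q - 1"
      and eq: "peval (A ?c) p (peval (A c) q (peval (A ?c) r ?v)) -
         peval (A ?c) r (peval (A c) q (peval (A ?c) p ?v)) =
      (\<Sum>j\<le>d ?c. peval (A ?c) (Z j) (peval (A c) q (E ?c j ?v))) -
      (\<Sum>i\<le>d ?c. E ?c i (peval (A c) q (peval (A ?c) (Z i) ?v)))"
      using antisymmetric_exchange[of q "degree q" ?c p r] False by auto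
    \<comment> \<open>The indices 0 to \<open>degree q - 1\<close> give at most
      \<open>degree q\<close> nodes, which is why the degree drops by one.\<close>
    have "\<exists>q'. degree q' \<le> degree q - 1 \<and> (\<forall>l\<in>{..min (d c) (degree q - 1)}. poly q' (\<theta> c l) = poly q (\<theta> c l))"
      by (intro poly_interpolation inj_on_subset[OF inj_\<theta>]) auto
    then obtain q' where q': "degree q' \<le> degree q - 1"
        "\<And>l. l \<le> degree q - 1 \<Longrightarrow> l \<le> d c \<Longrightarrow> poly q (\<theta> c l) = poly q' (\<theta> c l)"
      by force
    have "E c 0 (peval (A ?c) (Z j) (peval (A c) q (E ?c j ?v))) =
        E c 0 (E ?c j (peval (A c) q (peval (A ?c) (Z j) ?v)))" if j: "j \<le> d ?c" for j
    proof -
      \<comment> \<open>As a polynomial in \<open>A (\<not> c)\<close>, the projection can be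
        swapped with \<open>Z j\<close> by the induction hypothesis at \<open>q'\<close>.\<close>
      obtain L where L: "\<And>w. E ?c j w = peval (A ?c) L w" using E_eq_peval[OF j] by metis
      have "E c 0 (peval (A ?c) (Z j) (peval (A c) q (E ?c j ?v))) =
          E c 0 (peval (A ?c) (Z j) (peval (A c) q' (E ?c j ?v)))"
        by (rule truncate_left[OF Z q'(2)])
      also have "\<dots> = E c 0 (E ?c j (peval (A c) q' (peval (A ?c) (Z j) ?v)))"
        unfolding L using q'(1) False by (intro less.hyps) auto
      also have "\<dots> = E c 0 (E ?c j (peval (A c) q (peval (A ?c) (Z j) ?v)))"
        using truncate_right[OF Z q'(2)] by simp
      finally show ?thesis .
    qed
    then have "E c 0 (peval (A ?c) p (peval (A c) q (peval (A ?c) r ?v)) -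
         peval (A ?c) r (peval (A c) q (peval (A ?c) p ?v))) = 0"
      unfolding eq by (simp add: endo.linear_diff[OF linear_E] endo.linear_sum[OF linear_E])
    then show ?thesis by (simp add: endo.linear_diff[OF linear_E])
  qed
qed

text \<open>The case of \<open>corner_symmetric\<close> in which the middle polynomial represents
  \<open>E c 0\<close>.\<close>

lemma corner_commute:
  "E c 0 (peval (A (\<not> c)) p (E c 0 (peval (A (\<not> c)) r (E c 0 v)))) =
   E c 0 (peval (A (\<not> c)) r (E c 0 (peval (A (\<not> c)) p (E c 0 v))))"
proof -
  obtain L where "\<And>w. E c 0 w = peval (A c) L w" using E_eq_peval[of 0 c] by (metis le0)
  then show ?thesis using corner_symmetric[of c p L r v] by simp
qed

subsection \<open>Words in the two operators\<close>

text \<open>The operators alternate along the list, so only the first index is recorded; a constant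
  entry lets an operator follow itself.\<close>

fun word :: "bool \<Rightarrow> 'k poly list \<Rightarrow> 'v \<Rightarrow> 'v" where
  "word c [] v = v"
| "word c (p # ps) v = peval (A c) p (word (\<not> c) ps v)"

lemma word_append: "\<exists>c'. \<forall>ws v. word c (us @ ws) v = word c us (word c' ws v)"
proof (induction us arbitrary: c)
  case Nil
  then show ?case by auto
next
  case (Cons p us)
  then show ?case by (metis append_Cons word.simps(2))
qed

lemma linear_word: "Vector_Spaces.linear scale scale (word c us)"
proof (induction us arbitrary: c)
  case Nil
  have "word c [] = id" by auto
  then show ?case using linear_id by metis
next
  case (Cons p us)
  have "word c (p # us) = peval (A c) p \<circ> word (\<not> c) us" by auto
  then show ?case using Vector_Spaces.linear_compose[OF Cons linear_op] by metis
qed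

text \<open>Degree \<open>m - 1\<close> can match the \<open>m\<close> indices from 1 to
  \<open>m\<close>; the mismatch at index 0 is collected in \<open>a\<close>.\<close>

lemma truncate_poly:
  assumes "m > 0"
  shows "\<exists>q' a. degree q' \<le> m - 1 \<and>
    (\<forall>l. l \<le> m \<longrightarrow> l \<le> d c \<longrightarrow> poly q (\<theta> c l) = poly q' (\<theta> c l) + (if l = 0 then a else 0))"
proof -
  have "\<exists>q'. degree q' \<le> m - 1 \<and> (\<forall>l\<in>{1..min (d c) m}. poly q' (\<theta> c l) = poly q (\<theta> c l))"
    using assms by (intro poly_interpolation inj_on_subset[OF inj_\<theta>]) auto
  then obtain q' where "degree q' \<le> m - 1" "\<And>l. l \<in> {1..min (d c) m} \<Longrightarrow> poly q' (\<theta> c l) = poly q (\<theta> c l)"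
    by metis
  then show ?thesis
    by (intro exI[of _ q'] exI[of _ "poly q (\<theta> c 0) - poly q' (\<theta> c 0)"]) auto
qed

text \<open>Next to \<open>E c 0\<close> the factor \<open>q\<close> is seen at \<open>m + 1\<close>
  eigenvalues, one too many for degree \<open>m - 1\<close>. The excess at index 0 is a multiple of
  \<open>E c 0\<close>, which cuts the word there.\<close>

lemma reduce_left:
  assumes "degree p \<le> m" "m > 0"
  shows "\<exists>q' a. degree q' \<le> m - 1 \<and> (\<forall>v.
    E c 0 (peval (A (\<not> c)) p (peval (A c) q v)) =
    E c 0 (peval (A (\<not> c)) p (peval (A c) q' v)) + scale a (E c 0 (peval (A (\<not> c)) p (E c 0 v))))"
proof -
  obtain q' a where q': "degree q' \<le> m - 1"
    "\<And>l. l \<le> m \<Longrightarrow> l \<le> d c \<Longrightarrow> poly q (\<theta> c l) = poly q' (\<theta> c l) + (if l = 0 then a else 0)"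
    using truncate_poly[OF assms(2)] by metis
  obtain e where e: "\<And>i. i \<le> d c \<Longrightarrow> poly e (\<theta> c i) = (if i = 0 then 1 else 0)"
    and eE: "\<And>v. peval (A c) e v = E c 0 v"
    using E_eq_peval[of 0 c] by auto
  have "E c 0 (peval (A (\<not> c)) p (peval (A c) q v)) =
      E c 0 (peval (A (\<not> c)) p (peval (A c) (q' + smult a e) v))" for v
    by (rule truncate_left[OF assms(1)]) (use q'(2) e in auto)
  then show ?thesis using q'(1)
    by (intro exI[of _ q'] exI[of _ a])
       (auto simp: peval_add[OF linear_A] peval_smult[OF linear_A] eE endo.linear_add[OF linear_op] endo.linear_add[OF linear_E]
          endo.linear_scale[OF linear_op] endo.linear_scale[OF linear_E])
qed

lemma reduce_right:
  assumes "degree p \<le> m" "m > 0"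
  shows "\<exists>q' a. degree q' \<le> m - 1 \<and> (\<forall>v.
    peval (A c) q (peval (A (\<not> c)) p (E c 0 v)) =
    peval (A c) q' (peval (A (\<not> c)) p (E c 0 v)) + scale a (E c 0 (peval (A (\<not> c)) p (E c 0 v))))"
proof -
  obtain q' a where q': "degree q' \<le> m - 1"
    "\<And>l. l \<le> m \<Longrightarrow> l \<le> d c \<Longrightarrow> poly q (\<theta> c l) = poly q' (\<theta> c l) + (if l = 0 then a else 0)"
    using truncate_poly[OF assms(2)] by metis
  obtain e where e: "\<And>i. i \<le> d c \<Longrightarrow> poly e (\<theta> c i) = (if i = 0 then 1 else 0)"
    and eE: "\<And>v. peval (A c) e v = E c 0 v"
    using E_eq_peval[of 0 c] by auto
  have "peval (A c) q (peval (A (\<not> c)) p (E c 0 v)) =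
      peval (A c) (q' + smult a e) (peval (A (\<not> c)) p (E c 0 v))" for v
    by (rule truncate_right[OF assms(1)]) (use q'(2) e in auto)
  then show ?thesis using q'(1)
    by (intro exI[of _ q'] exI[of _ a]) (auto simp: peval_add[OF linear_A] peval_smult[OF linear_A] eE)
qed

text \<open>
  Induction on the length of the word, then on a bound \<open>m\<close> for the degree of one chosen factor,
  then on the position of that factor. Exchange bounds the factor to its left by \<open>m\<close> or the
  factor to its right by \<open>m - 1\<close>. At either end of the word, the factor next to it drops to degree
  \<open>m - 1\<close> modulo words that are cut by \<open>E a 0\<close>. A factor of degree 0 lets its neighbours merge.
\<close>

lemma word_in_line:
  assumes v: "E a 0 v = v"
    and eig: "\<And>p. E a 0 (peval (A (\<not> a)) p v) \<in> span {v}"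
  shows "E a 0 (word c ps v) \<in> span {v}"
proof (induction "length ps" arbitrary: c ps rule: less_induct)
  case less
  let ?good = "\<lambda>u. E a 0 u \<in> span {v}"
  have good_add: "?good (x + y)" if "?good x" "?good y" for x y
    using that by (simp add: endo.linear_add[OF linear_E] span_add)
  have good_scale: "?good (scale b x)" if "?good x" for b x
    using that by (simp add: endo.linear_scale[OF linear_E] span_scale)
  have good_sum: "?good (sum f I)" if "\<And>i. i \<in> I \<Longrightarrow> ?good (f i)" for f and I :: "nat set"
    using that by (simp add: endo.linear_sum[OF linear_E] span_sum)
  have line: "?good (T x)" if x: "x \<in> span {v}" and T: "?good (T v)" "Vector_Spaces.linear scale scale T" for T x
  proof -
    obtain b where "x = scale b v" using x by (auto simp: span_singleton)
    then show ?thesis using T(1) good_scale by (simp add: endo.linear_scale[OF T(2)])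
  qed
  \<comment> \<open>The chosen factor is \<open>q\<close>, at position \<open>length us\<close>; the
    whole word has at most \<open>length ps\<close> entries.\<close>
  have *: "?good (word c (us @ q # ws) v)"
    if "length us + length ws < length ps" "degree q \<le> m" for m us q ws c
    using that
  proof (induction m arbitrary: c us q ws)
    case 0
    then obtain b where b: "q = [:b:]" by (metis degree_eq_zeroE le_zero_eq)
    \<comment> \<open>The scalar is pulled out. At an end the word gets shorter; inside, its
      neighbours belong to the same operator and merge.\<close>
    show ?case
    proof (cases us rule: rev_cases)
      case Nil
      then show ?thesis using less 0
        by (simp add: b peval_const[OF linear_A] good_scale)
    next
      case (snoc us' p)
      obtain c' where c': "\<And>ws v. word c (us' @ ws) v = word c us' (word c' ws v)"
        using word_append by metis
      show ?thesis
      proof (cases ws)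
        case Nil
        then have "word c (us @ q # ws) v = scale b (word c (us' @ [p]) v)"
          by (simp add: snoc c' b peval_const[OF linear_A]
              endo.linear_scale[OF linear_op] endo.linear_scale[OF linear_word])
        then show ?thesis using less.hyps[of "us' @ [p]" c] 0 snoc by (simp add: good_scale)
      next
        case (Cons r ws')
        then have "word c (us @ q # ws) v = scale b (word c (us' @ (p * r) # ws') v)"
          by (simp add: snoc c' b peval_const[OF linear_A] peval_mult[OF linear_A]
              endo.linear_scale[OF linear_op] endo.linear_scale[OF linear_word])
        then show ?thesis
          using less.hyps[of "us' @ (p * r) # ws'" c] 0 snoc Cons by (simp add: good_scale)
      qed
    qed
  next
    case (Suc m)
    note outer = Suc.IH
    from Suc.prems show ?case
    proof (induction us arbitrary: c q ws rule: rev_induct)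
      case Nil
      show ?case
      proof (cases "c = a")
        case True
        then show ?thesis using less.hyps[of ws "\<not> a"] Nil by (simp add: E_peval span_scale)
      next
        case c: False
        then have c: "c = (\<not> a)" by simp
        show ?thesis
        proof (cases ws)
          case Nil
          then show ?thesis using eig c by simp
        next
          case (Cons r ws')
          let ?w = "word (\<not> a) ws' v"
          \<comment> \<open>The neighbour \<open>r\<close> becomes the chosen factor with bound
            \<open>m\<close>. In the cut term the part after \<open>E a 0\<close> is a shorter word,
            hence in the line, and \<open>eig\<close> treats the rest.\<close>
          obtain r' b where r': "degree r' \<le> m" and
            eq: "E a 0 (word c (q # r # ws') v) = E a 0 (word c (q # r' # ws') v) +
              scale b (E a 0 (peval (A (\<not> a)) q (E a 0 ?w)))"
            using reduce_left[of q "Suc m" a r] Nil.prems c by auto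
          have "E a 0 (word c (q # r' # ws') v) \<in> span {v}"
            using outer[of "[q]" ws' r' c] Nil.prems r' Cons by simp
          moreover have "E a 0 (peval (A (\<not> a)) q (E a 0 ?w)) \<in> span {v}"
            using less.hyps[of ws' "\<not> a"] Nil.prems Cons by (intro line[OF _ eig linear_op]) simp
          ultimately show ?thesis unfolding Cons append_Nil eq by (intro span_add span_scale)
        qed
      qed
    next
      case (snoc p us)
      obtain c' where c': "\<And>ws v. word c (us @ ws) v = word c us (word c' ws v)"
        using word_append by metis
      show ?case
      proof (cases ws)
        case Nil
        show ?thesis
        proof (cases "c' = a")
          case False
          then have "(\<not> c') = a" by simp
          \<comment> \<open>Here \<open>q\<close> is evaluated at \<open>A a\<close>, of which
            \<open>v\<close> is an eigenvector.\<close>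
          moreover have "peval (A a) q v = scale (poly q (\<theta> a 0)) v"
            using peval_E[of 0 a q v] v by simp
          ultimately have "word c ((us @ [p]) @ q # ws) v = scale (poly q (\<theta> a 0)) (word c (us @ [p]) v)"
            by (simp add: Nil c' endo.linear_scale[OF linear_op] endo.linear_scale[OF linear_word])
          then show ?thesis using less.hyps[of "us @ [p]" c] snoc.prems by (simp add: good_scale)
        next
          case True
          let ?x = "E a 0 (peval (A (\<not> a)) q v)"
          obtain p' b where p': "degree p' \<le> m" and
            eq: "peval (A a) p (peval (A (\<not> a)) q v) = peval (A a) p' (peval (A (\<not> a)) q v) + scale b ?x"
            using reduce_right[of q "Suc m" a p] snoc.prems v by (metis diff_Suc_1 zero_less_Suc)
          have "word c ((us @ [p]) @ q # ws) v = word c (us @ p' # [q]) v + scale b (word c us ?x)"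
            by (simp add: Nil c' True eq endo.linear_add[OF linear_word] endo.linear_scale[OF linear_word])
          moreover have "?good (word c (us @ p' # [q]) v)"
            using outer[of us "[q]" p' c] p' snoc.prems by simp
          moreover have "?good (word c us ?x)"
            using less.hyps[of us c] snoc.prems by (intro line[OF eig _ linear_word]) simp
          ultimately show ?thesis using good_add good_scale by presburger
        qed
      next
        case (Cons r ws')
        let ?w = "word (\<not> c') ws' v"
        \<comment> \<open>In the first sum \<open>P j\<close> is the chosen factor, one place
          further left with the same bound; in the second \<open>R i\<close> is, with the smaller
          bound \<open>m\<close>. The projections fill the vacated entries, so the length is
          unchanged.\<close>
        obtain P R where PR: "(\<forall>i. degree (P i) \<le> Suc m \<and> degree (R i) \<le> Suc m - 1) \<and>
          (\<forall>w. peval (A c') p (peval (A (\<not> c')) q (peval (A c') r w)) =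
            (\<Sum>j\<le>d c'. peval (A c') (P j) (peval (A (\<not> c')) q (E c' j w))) +
            (\<Sum>i\<le>d c'. E c' i (peval (A (\<not> c')) q (peval (A c') (R i) w))))"
          using exchange[OF snoc.prems(2) zero_less_Suc, of c' p r] by blast
        then have eq: "peval (A c') p (peval (A (\<not> c')) q (peval (A c') r ?w)) =
            (\<Sum>j\<le>d c'. peval (A c') (P j) (peval (A (\<not> c')) q (E c' j ?w))) +
            (\<Sum>i\<le>d c'. E c' i (peval (A (\<not> c')) q (peval (A c') (R i) ?w)))"
          by blast
        have "?good (word c us (peval (A c') (P j) (peval (A (\<not> c')) q (E c' j ?w))))"
          if j: "j \<le> d c'" for j
        proof -
          obtain L where L: "\<And>w. peval (A c') L w = E c' j w" using E_eq_peval[OF j] by metis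
          show ?thesis
            using snoc.IH[of "q # L # ws'" "P j" c] PR snoc.prems Cons by (simp add: c' L)
        qed
        moreover have "?good (word c us (E c' i (peval (A (\<not> c')) q (peval (A c') (R i) ?w))))"
          if i: "i \<le> d c'" for i
        proof -
          obtain L where L: "\<And>w. peval (A c') L w = E c' i w" using E_eq_peval[OF i] by metis
          show ?thesis
            using outer[of "us @ [L, q]" ws' "R i" c] PR snoc.prems Cons by (simp add: c' L)
        qed
        moreover have "word c ((us @ [p]) @ q # ws) v =
            (\<Sum>j\<le>d c'. word c us (peval (A c') (P j) (peval (A (\<not> c')) q (E c' j ?w)))) +
            (\<Sum>i\<le>d c'. word c us (E c' i (peval (A (\<not> c')) q (peval (A c') (R i) ?w))))"
          by (simp add: Cons c' eq endo.linear_add[OF linear_word] endo.linear_sum[OF linear_word])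
        ultimately show ?thesis by (simp only:) (intro good_add good_sum; simp)
      qed
    qed
  qed
  show ?case
  proof (cases ps)
    case Nil
    then show ?thesis using v by (simp add: span_base)
  next
    case (Cons p ps')
    then show ?thesis using *[of "[]" ps' p "degree p" c] by simp
  qed
qed

text \<open>The words applied to \<open>v\<close> span an invariant subspace, hence everything, and
  \<open>word_in_line\<close> sends each of them into the line.\<close>

lemma corner_eq_line:
  assumes v: "E a 0 v = v" "v \<noteq> 0"
    and eig: "\<And>p. E a 0 (peval (A (\<not> a)) p v) \<in> span {v}"
    and irred: "\<And>W. subspace W \<Longrightarrow> (\<And>c. A c ` W \<subseteq> W) \<Longrightarrow> W = {0} \<or> W = UNIV"
  shows "range (E a 0) = span {v}"
proof -
  define W where "W = span (range (\<lambda>(c, ps). word c ps v))"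
  have "A c w \<in> W" if "w \<in> W" for c w
    using that unfolding W_def
  proof (induction rule: span_induct_alt)
    case base
    show ?case by (simp add: endo.linear_0[OF linear_A] span_zero)
  next
    case (step b x y)
    then obtain c' ps where x: "x = word c' ps v" by auto
    \<comment> \<open>If the word already starts with \<open>A c\<close>, the entry
      \<open>[1]\<close> restores the alternation.\<close>
    have "A c x = word c ([:0, 1:] # (if c' = c then [1] else []) @ ps) v"
      unfolding x
      by (auto simp: peval_pCons[OF linear_A] endo.linear_0[OF linear_A] one_pCons)
    then have "A c x \<in> range (\<lambda>(c, ps). word c ps v)"
      by (intro range_eqI[of _ _ "(c, [:0, 1:] # (if c' = c then [1] else []) @ ps)"]) (simp only: prod.case)
    then have "A c x \<in> span (range (\<lambda>(c, ps). word c ps v))" by (rule span_base)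
    then show ?case using step
      by (simp add: endo.linear_add[OF linear_A] endo.linear_scale[OF linear_A] span_add span_scale)
  qed
  then have "A c ` W \<subseteq> W" for c by auto
  moreover have "v \<in> W"
    unfolding W_def by (intro span_base) (auto intro!: image_eqI[of _ _ "(a, [])"])
  ultimately have "W = UNIV" using irred[of W] v(2) by (auto simp: W_def)
  have "E a 0 w \<in> span {v}" if "w \<in> W" for w
    using that unfolding W_def
  proof (induction rule: span_induct_alt)
    case base
    show ?case by (simp add: endo.linear_0[OF linear_E] span_zero)
  next
    case (step b x y)
    then show ?case using word_in_line[OF v(1) eig]
      by (auto simp: endo.linear_add[OF linear_E] endo.linear_scale[OF linear_E]
          intro!: span_add span_scale)
  qed
  moreover have "span {v} \<subseteq> range (E a 0)"
  proof
    fix w assume "w \<in> span {v}"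
    then obtain b where "w = scale b v" by (auto simp: span_singleton)
    then have "w = E a 0 w" using v by (simp add: endo.linear_scale[OF linear_E])
    then show "w \<in> range (E a 0)" by blast
  qed
  ultimately show ?thesis using \<open>W = UNIV\<close> by auto
qed

end

subsection \<open>Common eigenvectors and the corner algebra\<close>

text \<open>Take \<open>p\<close> of least degree annihilating some nonzero \<open>u\<close> in
  \<open>U\<close>, and split off a root \<open>a\<close>. The cofactor applied to \<open>u\<close>
  is nonzero by minimality, and \<open>T - a\<close> kills it.\<close>

lemma eigenvector_exists:
  fixes scale :: "'k::alg_closed_field \<Rightarrow> 'v::ab_group_add \<Rightarrow> 'v"
  assumes fin: "finite_dimensional_vector_space scale Basis"
    and T: "Vector_Spaces.linear scale scale T"
    and U: "module.subspace scale U" "T ` U \<subseteq> U" "U \<noteq> {0}"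
  shows "\<exists>u\<in>U. u \<noteq> 0 \<and> (\<exists>a. T u = scale a u)"
proof -
  interpret fin: finite_dimensional_vector_space scale Basis by fact
  interpret operator_polynomials scale ..
  obtain u where u: "u \<in> U" "u \<noteq> 0" using U fin.subspace_0[OF U(1)] by auto
  have UI: "peval T p u \<in> U" for p
    by (induction p)
       (use U u fin.subspace_0[OF U(1)] in \<open>auto simp: peval_pCons[OF T] intro!: fin.subspace_add fin.subspace_scale\<close>)
  obtain p where p: "p \<noteq> 0" "peval T p u = 0"
    and min: "\<And>q. q \<noteq> 0 \<and> peval T q u = 0 \<Longrightarrow> degree p \<le> degree q"
    using annihilating_polynomial[OF fin T, of u]
      ex_has_least_nat[of "\<lambda>p. p \<noteq> 0 \<and> peval T p u = 0" _ degree] by blast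
  have "degree p > 0"
  proof (rule ccontr)
    assume "\<not> degree p > 0"
    then obtain a where "p = [:a:]" by (metis degree_eq_zeroE gr0I)
    then show False using p u by (simp add: peval_const[OF T])
  qed
  then obtain a where "poly p a = 0" using alg_closed_imp_poly_has_root by blast
  then obtain q where q: "p = [:- a, 1:] * q" unfolding poly_eq_0_iff_dvd by (elim dvdE)
  then have "q \<noteq> 0" using p by auto
  then have "degree q < degree p" unfolding q by (subst degree_mult_eq) auto
  then have "peval T q u \<noteq> 0" using min[of q] \<open>q \<noteq> 0\<close> by auto
  moreover have "T (peval T q u) = scale a (peval T q u)"
    using p(2) unfolding q peval_mult[OF T]
    by (simp add: peval_pCons[OF T] endo.linear_0[OF T])
  ultimately show ?thesis using UI by blast
qed

text \<open>An eigenspace of one operator inside \<open>U\<close> is invariant under the operators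
  commuting with it on \<open>U\<close>, so \<open>U\<close> can be shrunk one operator at a
  time.\<close>

lemma common_eigenvector_exists:
  fixes scale :: "'k::alg_closed_field \<Rightarrow> 'v::ab_group_add \<Rightarrow> 'v"
  assumes fin: "finite_dimensional_vector_space scale Basis"
    and "finite I" and T: "\<And>i. i \<in> I \<Longrightarrow> Vector_Spaces.linear scale scale (T i)"
    and U: "module.subspace scale U" "U \<noteq> {0}" "\<And>i. i \<in> I \<Longrightarrow> T i ` U \<subseteq> U"
    and comm: "\<And>i j u. i \<in> I \<Longrightarrow> j \<in> I \<Longrightarrow> u \<in> U \<Longrightarrow> T i (T j u) = T j (T i u)"
  shows "\<exists>u\<in>U. u \<noteq> 0 \<and> (\<forall>i\<in>I. \<exists>a. T i u = scale a u)"
  using assms(2-)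
proof (induction I arbitrary: U rule: finite_induct)
  case empty
  interpret fin: finite_dimensional_vector_space scale Basis by fact
  show ?case using empty fin.subspace_0 by fastforce
next
  case (insert j I)
  interpret fin: finite_dimensional_vector_space scale Basis by fact
  interpret operator_polynomials scale ..
  have Tj: "Vector_Spaces.linear scale scale (T j)" using insert.prems by simp
  obtain u a where u: "u \<in> U" "u \<noteq> 0" "T j u = scale a u"
    using eigenvector_exists[OF fin Tj insert.prems(2) insert.prems(4)[of j] insert.prems(3)] by auto
  let ?U = "{v \<in> U. T j v = scale a v}"
  have "fin.subspace ?U"
    using insert.prems(2) unfolding fin.subspace_def
    by (auto simp: endo.linear_0[OF Tj] endo.linear_add[OF Tj] endo.linear_scale[OF Tj]
        fin.scale_right_distrib mult.commute)
  moreover have "?U \<noteq> {0}" using u by auto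
  moreover have "T i ` ?U \<subseteq> ?U" if "i \<in> I" for i
  proof -
    have "T j (T i v) = scale a (T i v)" if "v \<in> ?U" for v
      using insert.prems(5)[of j i v] that \<open>i \<in> I\<close> endo.linear_scale[OF insert.prems(1)[of i], of a v] by auto
    then show ?thesis using insert.prems(4)[of i] that by auto
  qed
  ultimately have "\<exists>u\<in>?U. u \<noteq> 0 \<and> (\<forall>i\<in>I. \<exists>a. T i u = scale a u)"
    using insert.prems by (intro insert.IH) auto
  then show ?case by auto
qed

lemma dim_corner:
  fixes scale :: "'k::alg_closed_field \<Rightarrow> 'v::ab_group_add \<Rightarrow> 'v"
  assumes fin: "finite_dimensional_vector_space scale Basis"
    and "tridiagonal_system scale A d \<theta> E"
    and nz: "range (E a 0) \<noteq> {0}"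
    and irred: "\<And>W. module.subspace scale W \<Longrightarrow> (\<And>c. A c ` W \<subseteq> W) \<Longrightarrow> W = {0} \<or> W = UNIV"
  shows "vector_space.dim scale (range (E a 0)) = 1"
proof -
  interpret fin: finite_dimensional_vector_space scale Basis by fact
  interpret tridiagonal_system scale A d \<theta> E by fact
  \<comment> \<open>Every polynomial in \<open>A (\<not> a)\<close> is a combination of the
    \<open>E (\<not> a) i\<close>, so a common eigenvector of these finitely many operators
    suffices.\<close>
  let ?T = "\<lambda>i v. E a 0 (E (\<not> a) i v)"
  have lin: "Vector_Spaces.linear scale scale (?T i)" for i
    using Vector_Spaces.linear_compose[OF linear_E[of "\<not> a" i] linear_E[of a 0]] by (simp add: o_def)
  have sub: "fin.subspace (range (E a 0))"
    using endo.linear_subspace_image[OF linear_E fin.subspace_UNIV] .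
  have comm: "?T i (?T j u) = ?T j (?T i u)"
    if "i \<in> {..d (\<not> a)}" "j \<in> {..d (\<not> a)}" "u \<in> range (E a 0)" for i j u
  proof -
    obtain p where "\<And>v. peval (A (\<not> a)) p v = E (\<not> a) i v"
      using E_eq_peval \<open>i \<in> {..d (\<not> a)}\<close> by (metis atMost_iff)
    moreover obtain q where "\<And>v. peval (A (\<not> a)) q v = E (\<not> a) j v"
      using E_eq_peval \<open>j \<in> {..d (\<not> a)}\<close> by (metis atMost_iff)
    ultimately show ?thesis using corner_commute[of a p q] \<open>u \<in> range (E a 0)\<close> by auto
  qed
  have "\<exists>v\<in>range (E a 0). v \<noteq> 0 \<and> (\<forall>i\<in>{..d (\<not> a)}. \<exists>b. ?T i v = scale b v)"
    by (rule common_eigenvector_exists[where T = ?T, OF fin finite_atMost lin sub nz _ comm]) auto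
  then obtain v where v: "v \<in> range (E a 0)" "v \<noteq> 0" "\<forall>i\<in>{..d (\<not> a)}. \<exists>b. ?T i v = scale b v"
    by blast
  have Ev: "E a 0 v = v" using v(1) by (auto simp: E_E)
  have "E a 0 (peval (A (\<not> a)) p v) \<in> fin.span {v}" for p
  proof -
    have "?T i v \<in> fin.span {v}" if i: "i \<in> {..d (\<not> a)}" for i
      using bspec[OF v(3) i] by (auto simp: fin.span_singleton)
    then show ?thesis
      unfolding peval_eq_sum endo.linear_sum[OF linear_E] endo.linear_scale[OF linear_E]
      by (auto intro!: fin.span_sum fin.span_scale)
  qed
  then have "range (E a 0) = fin.span {v}"
    by (rule corner_eq_line[OF Ev v(2) _ irred])
  then show ?thesis using v(2) by simp
qed

subsection \<open>From standard orderings to tridiagonal systems\<close>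

locale eigenprojections =
  fixes scale :: "'k::field \<Rightarrow> 'v::ab_group_add \<Rightarrow> 'v" and T :: "'v \<Rightarrow> 'v"
    and V :: "nat \<Rightarrow> 'v set" and n :: nat and \<theta> :: "nat \<Rightarrow> 'k" and E :: "nat \<Rightarrow> 'v \<Rightarrow> 'v"
  assumes inj: "inj_on \<theta> {..n}"
    and linear: "Vector_Spaces.linear scale scale (E i)"
    and sum: "(\<Sum>i\<le>n. E i v) = v"
    and compose: "i \<le> n \<Longrightarrow> j \<le> n \<Longrightarrow> E i (E j v) = (if i = j then E i v else 0)"
    and eigenvalue: "i \<le> n \<Longrightarrow> T (E i v) = scale (\<theta> i) (E i v)"
    and range: "i \<le> n \<Longrightarrow> range (E i) = V i"
    and on_eigenspace: "i \<le> n \<Longrightarrow> j \<le> n \<Longrightarrow> v \<in> V j \<Longrightarrow> E i v = (if i = j then v else 0)"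

text \<open>The projections are Lagrange polynomials in \<open>T\<close>. Since the eigenspaces
  span, each identity needs checking on eigenvectors only (\<open>ext\<close>).\<close>

lemma eigenprojections_exist:
  fixes scale :: "'k::field \<Rightarrow> 'v::ab_group_add \<Rightarrow> 'v" and V :: "nat \<Rightarrow> 'v set"
  assumes "vector_space scale" and T: "Vector_Spaces.linear scale scale T"
    and diag: "diagonalizable scale T" and V: "bij_betw V {0..n} (eigenspaces scale T)"
  shows "\<exists>\<theta> E. eigenprojections scale T V n \<theta> E"
proof -
  interpret vector_space scale by fact
  interpret operator_polynomials scale ..
  have "\<exists>\<theta>. V i = eigenspace scale T \<theta>" if i: "i \<le> n" for i
  proof -
    have "V i \<in> eigenspaces scale T" using bij_betwE[OF V] i by simp
    then show ?thesis unfolding eigenspaces_def by blast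
  qed
  then obtain \<theta> where \<theta>: "\<And>i. i \<le> n \<Longrightarrow> V i = eigenspace scale T (\<theta> i)" by metis
  have inj: "inj_on \<theta> {..n}"
  proof (rule inj_onI)
    fix i j assume ij: "i \<in> {..n}" "j \<in> {..n}" "\<theta> i = \<theta> j"
    then have "V i = V j" using \<theta> by simp
    then show "i = j" using ij V by (auto simp: bij_betw_def inj_on_def)
  qed
  have "\<exists>p. \<forall>j\<in>{..n}. poly p (\<theta> j) = (if i = j then 1 else 0)" for i
    using poly_interpolation[OF finite_atMost inj, of n "\<lambda>j. if i = j then 1 else 0"] by (metis card_atMost order_refl)
  then obtain L where L: "\<And>i j. j \<le> n \<Longrightarrow> poly (L i) (\<theta> j) = (if i = j then 1 else 0)"
    by (metis atMost_iff)
  define E where "E i = peval T (L i)" for i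
  have lin: "Vector_Spaces.linear scale scale (E i)" for i
    unfolding E_def by (rule linear_peval[OF T])
  have EV: "E i v = (if i = j then v else 0)" if "j \<le> n" "v \<in> V j" for i j v
    using that peval_eigenvector[OF T, of v "\<theta> j" "L i"] L[of j i] \<theta>[of j]
    by (auto simp: E_def eigenspace_def)
  have "span (\<Union>i\<le>n. V i) = UNIV"
    using diag V unfolding diagonalizable_def bij_betw_def by (simp add: atLeast0AtMost)
  then have ext: "f w = g w" if "Vector_Spaces.linear scale scale f" "Vector_Spaces.linear scale scale g"
    "\<And>j v. j \<le> n \<Longrightarrow> v \<in> V j \<Longrightarrow> f v = g v" for f g w
    using endo.linear_eq_on_span[OF that(1,2), of "\<Union>i\<le>n. V i" w] that(3) by auto
  have sum: "(\<Sum>i\<le>n. E i v) = v" for v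
  proof (rule ext[where g = "\<lambda>v. v"])
    show "Vector_Spaces.linear scale scale (\<lambda>v. v)" using linear_id by (simp add: id_def)
  qed (auto intro!: endo.linear_compose_sum lin simp: EV)
  have E_E: "E i (E j v) = (if i = j then E i v else 0)" if "i \<le> n" "j \<le> n" for i j v
  proof (rule ext[where f = "\<lambda>v. E i (E j v)"])
    show "Vector_Spaces.linear scale scale (\<lambda>v. E i (E j v))"
      using Vector_Spaces.linear_compose[OF lin[of j] lin[of i]] by (simp add: o_def)
    show "Vector_Spaces.linear scale scale (\<lambda>v. if i = j then E i v else 0)"
      using lin endo.linear_zero by (cases "i = j") auto
  qed (auto simp: EV endo.linear_0[OF lin])
  have T_E: "T (E i v) = scale (\<theta> i) (E i v)" if "i \<le> n" for i v
  proof (rule ext[where f = "\<lambda>v. T (E i v)"])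
    show "Vector_Spaces.linear scale scale (\<lambda>v. T (E i v))"
      using Vector_Spaces.linear_compose[OF lin[of i] T] by (simp add: o_def)
    show "Vector_Spaces.linear scale scale (\<lambda>v. scale (\<theta> i) (E i v))"
      by (intro endo.linear_compose_scale_right lin)
  qed (use that in \<open>auto simp: EV endo.linear_0[OF T] \<theta> eigenspace_def\<close>)
  have ran: "range (E i) = V i" if "i \<le> n" for i
  proof
    show "range (E i) \<subseteq> V i" using T_E that \<theta> by (auto simp: eigenspace_def)
    show "V i \<subseteq> range (E i)" using EV[OF that] by (metis rangeI subsetI)
  qed
  have "eigenprojections scale T V n \<theta> E"
    by (rule eigenprojections.intro) (use inj lin sum E_E T_E ran EV in simp_all)
  then show ?thesis by blast
qed

lemma (in eigenprojections) tridiagonal: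
  assumes "standard_ordering scale T B n V" and ij: "i \<le> n" "j \<le> n" "i + 1 < j \<or> j + 1 < i"
  shows "E i (B (E j v)) = 0"
proof -
  interpret E: module_hom scale scale "E i" using linear by (simp add: Vector_Spaces.linear_def)
  have "B (E j v) \<in> neighbour_sum n V j"
    using assms(1) ij(2) range[OF ij(2)] unfolding standard_ordering_def by blast
  then obtain x y z where xyz: "B (E j v) = x + y + z" "x \<in> (if j = 0 then {0} else V (j - 1))"
    "y \<in> V j" "z \<in> (if j < n then V (j + 1) else {0})"
    unfolding neighbour_sum_def by blast
  have "E i x = 0" using xyz(2) on_eigenspace[of i "j - 1" x] ij by (auto simp: E.zero split: if_splits)
  moreover have "E i y = 0" using xyz(3) on_eigenspace[of i j y] ij by auto
  moreover have "E i z = 0" using xyz(4) on_eigenspace[of i "j + 1" z] ij by (auto simp: E.zero split: if_splits)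
  ultimately show ?thesis by (simp add: xyz(1) E.add)
qed

text \<open>\<open>dim_corner\<close> with index \<open>True\<close> standing for \<open>A\<close>
  and \<open>False\<close> for \<open>As\<close>. The ordering is arbitrary, so the result also
  applies to a reversed one.\<close>

lemma dim_first_eigenspace:
  fixes scale :: "'k::alg_closed_field \<Rightarrow> 'v::ab_group_add \<Rightarrow> 'v"
  assumes fin: "finite_dimensional_vector_space scale Basis"
    and tdp: "tridiagonal_pair scale A As"
    and V: "standard_ordering scale A As n V"
  shows "vector_space.dim scale (V 0) = 1"
proof -
  interpret fin: finite_dimensional_vector_space scale Basis by fact
  obtain m Vs where Vs: "standard_ordering scale As A m Vs"
    using tdp unfolding tridiagonal_pair_def by blast
  have T: "Vector_Spaces.linear scale scale A" "Vector_Spaces.linear scale scale As"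
    "diagonalizable scale A" "diagonalizable scale As"
    using tdp unfolding tridiagonal_pair_def by blast+
  have bij: "bij_betw V {0..n} (eigenspaces scale A)" "bij_betw Vs {0..m} (eigenspaces scale As)"
    using V Vs unfolding standard_ordering_def by blast+
  obtain \<theta> E where "eigenprojections scale A V n \<theta> E"
    using eigenprojections_exist[OF fin.vector_space_axioms T(1,3) bij(1)] by blast
  then interpret P: eigenprojections scale A V n \<theta> E .
  obtain \<theta>s Es where "eigenprojections scale As Vs m \<theta>s Es"
    using eigenprojections_exist[OF fin.vector_space_axioms T(2,4) bij(2)] by blast
  then interpret Ps: eigenprojections scale As Vs m \<theta>s Es .
  let ?A = "\<lambda>c. if c then A else As" and ?d = "\<lambda>c. if c then n else m"
    and ?\<theta> = "\<lambda>c. if c then \<theta> else \<theta>s" and ?E = "\<lambda>c. if c then E else Es"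
  have system: "tridiagonal_system scale ?A ?d ?\<theta> ?E"
  proof (intro tridiagonal_system.intro tridiagonal_system_axioms.intro
      operator_polynomials.intro fin.vector_space_axioms)
    fix c i j v
    assume "i \<le> ?d c" "j \<le> ?d c" "i + 1 < j \<or> j + 1 < i"
    then show "?E c i (?A (\<not> c) (?E c j v)) = 0"
      using P.tridiagonal[OF V, of i j v] Ps.tridiagonal[OF Vs, of i j v]
      by (cases c) simp_all
  qed (use T P.inj Ps.inj P.linear Ps.linear P.sum Ps.sum P.compose Ps.compose P.eigenvalue Ps.eigenvalue
      in \<open>simp_all split: if_splits\<close>)
  have V0: "range (?E True 0) = V 0" using P.range by simp
  have "V 0 \<in> eigenspaces scale A" using bij_betwE[OF bij(1)] by simp
  then have "V 0 \<noteq> {0}" unfolding eigenspaces_def by blast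
  then have "range (?E True 0) \<noteq> {0}" unfolding V0 .
  moreover have "W = {0} \<or> W = UNIV" if "fin.subspace W" "\<And>c. ?A c ` W \<subseteq> W" for W
  proof -
    have "A ` W \<subseteq> W" "As ` W \<subseteq> W" using that(2)[of True] that(2)[of False] by simp_all
    then show ?thesis using tdp that(1) unfolding tridiagonal_pair_def by blast
  qed
  ultimately have "fin.dim (range (?E True 0)) = 1"
    by (rule dim_corner[OF fin system])
  then show ?thesis unfolding V0 .
qed

section \<open>Passage to the other operator and to the last eigenspace\<close>

lemma tridiagonal_pair_commute: "tridiagonal_pair scale A As \<longleftrightarrow> tridiagonal_pair scale As A"
  unfolding tridiagonal_pair_def by blast

lemma standard_ordering_reverse:
  assumes "standard_ordering scale A B n V"
  shows "standard_ordering scale A B n (\<lambda>i. V (n - i))"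
proof -
  have "bij_betw (\<lambda>i. n - i) {0..n} {0..n}"
    by (rule bij_betw_byWitness[where f' = "\<lambda>i. n - i"]) auto
  from bij_betw_trans[OF this] have "bij_betw (\<lambda>i. V (n - i)) {0..n} (eigenspaces scale A)"
    using assms unfolding standard_ordering_def o_def by blast
  moreover have "B ` V (n - i) \<subseteq> neighbour_sum n (\<lambda>i. V (n - i)) i" if "i \<le> n" for i
  proof
    fix w assume "w \<in> B ` V (n - i)"
    then have "w \<in> neighbour_sum n V (n - i)"
      using assms unfolding standard_ordering_def by (metis diff_le_self subsetD)
    then obtain x y z where w: "w = x + y + z" "x \<in> (if n - i = 0 then {0} else V (n - i - 1))"
      "y \<in> V (n - i)" "z \<in> (if n - i < n then V (n - i + 1) else {0})"
      unfolding neighbour_sum_def by blast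
    \<comment> \<open>Reversal exchanges the lower and the upper neighbour.\<close>
    have "w = z + y + x" by (simp add: w(1) ac_simps)
    moreover have "z \<in> (if i = 0 then {0} else V (n - (i - 1)))"
      using w(4) that by (auto split: if_splits simp: Suc_diff_le)
    moreover have "x \<in> (if i < n then V (n - (i + 1)) else {0})"
      using w(2) that by (auto split: if_splits)
    ultimately show "w \<in> neighbour_sum n (\<lambda>i. V (n - i)) i"
      unfolding neighbour_sum_def using w(3) by blast
  qed
  ultimately show ?thesis unfolding standard_ordering_def by blast
qed

theorem theorem1p3:
  fixes scale :: "'k::alg_closed_field \<Rightarrow> 'v::ab_group_add \<Rightarrow> 'v"
    and Basis :: "'v set"
    and A As :: "'v \<Rightarrow> 'v"
  assumes "finite_dimensional_vector_space scale Basis"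
    and "vector_space.dim scale (UNIV :: 'v set) > 0"
    and "tridiagonal_pair scale A As"
  shows "sharp scale A As"
proof -
  \<comment> \<open>\<open>has_rho\<close> at index 0 concerns the first and last eigenspaces of
    both operators: swapping the pair reaches \<open>As\<close>, reversing an ordering reaches the
    last eigenspace.\<close>
  note commuted = iffD1[OF tridiagonal_pair_commute assms(3)]
  note first = dim_first_eigenspace[OF assms(1,3)] dim_first_eigenspace[OF assms(1) commuted]
  show ?thesis
    unfolding sharp_def has_rho_def
    using assms(3) first first[OF standard_ordering_reverse] by simp
qed

end
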